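(* Let $V$ be a real vector space of dimension $3$ with an inner product $\langle\cdot,\cdot\rangle$, let $\mathcal{B}$ be an orthonormal basis of $V$, and orient $V$ so that $\mathcal{B}$ is positively oriented. Let $u\in V$ be a unit vector with coordinates $(a,b,c)^t$ with respect to $\mathcal{B}$ (so $a^2+b^2+c^2=1$), let $E=\mathbb{R}u$, let $E^{\perp}$ be its orthogonal complement, and let $\alpha\in[0,2\pi)$. Let $R$ and $S$ be the matrices with respect to $\mathcal{B}$ of the rotation $r_{E,\alpha}$ around the axis $E$ (directed by $u$) through the angle $\alpha$ in the positive sense and of the orthogonal symmetry $s_{E^{\perp}}$ on the plane $E^{\perp}$, respectively. Put $$A=\begin{pmatrix} a^2&ab&ac\\ ab&b^2&bc\\ ac&bc&c^2\end{pmatrix},\qquad B=\begin{pmatrix} 0&-c&b\\ c&0&-a\\ -b&a&0\end{pmatrix},$$ and let $I$ be the $3\times3$ identity matrix. Then $s_{E^{\perp}}\circ r_{E,\alpha}=r_{E,\alpha}\circ s_{E^{\perp}}$, and the matrix of this composition with respect to $\mathcal{B}$ is $$SR=RS=S+(\sin\alpha)B+(\cos\alpha-1)(I-A)\in M_3(\mathbb{Q}(a,b,c,\cos\alpha,\sin\alpha)).$$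
   Context: Coordinates of vectors are written as columns. $\mathbb{Q}(a,b,c,\cos\alpha,\sin\alpha)$ denotes the subfield of $\mathbb{R}$ generated by the indicated numbers, and $M_3(F)$ is the set of $3\times3$ matrices with entries in $F$. The vector product $\wedge$ on $V$ is the usual one for the given inner product and orientation (the standard cross product in $\mathcal{B}$-coordinates). The rotation $r_{E,\alpha}$ around the axis $E$ directed by $u$, of amplitude $\alpha$ and positive sense, is the linear map $V\to V$ with $r_{E,\alpha}(u)=u$ and, for every unit vector $v$ perpendicular to $u$, $r_{E,\alpha}(v)=(\cos\alpha)v+(\sin\alpha)(u\wedge v)$ and $r_{E,\alpha}(u\wedge v)=-(\sin\alpha)v+(\cos\alpha)(u\wedge v)$. The symmetry $s_{E^{\perp}}$ is the linear map $V\to V$ that sends $u$ to $-u$ and fixes every vector of $E^{\perp}$. The composition $s_{E^{\perp}}\circ r_{E,\alpha}$ is called a roto-symmetry. *)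

theory Defs
  imports "HOL-Analysis.Analysis" "HOL-Algebra.Algebraic_Closure_Type" "HOL-Algebra.Generated_Fields"
begin

definition orthonormal_basis :: "(3 \<Rightarrow> 'a::real_inner) \<Rightarrow> bool"
  where "orthonormal_basis e \<longleftrightarrow>
    (\<forall>i j. e i \<bullet> e j = (if i = j then 1 else 0)) \<and> span (range e) = UNIV"

definition coords :: "(3 \<Rightarrow> 'a::real_inner) \<Rightarrow> 'a \<Rightarrow> real^3"
  where "coords e v = (\<chi> i. representation (range e) v (e i))"

definition matrix_wrt :: "(3 \<Rightarrow> 'a::real_inner) \<Rightarrow> ('a \<Rightarrow> 'a) \<Rightarrow> real^3^3"
  where "matrix_wrt e f = (\<chi> i j. coords e (f (e j)) $ i)"

text \<open>The orientation of the space is the one for which the ordered basis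
  \<open>e 1, e 2, e 3\<close> is positive; it enters through the vector product.\<close>

definition vector_prod :: "(3 \<Rightarrow> 'a::real_inner) \<Rightarrow> 'a \<Rightarrow> 'a \<Rightarrow> 'a"
  where "vector_prod e v w = (\<Sum>i\<in>UNIV. cross3 (coords e v) (coords e w) $ i *\<^sub>R e i)"

text \<open>The next two descriptions are definite only when \<open>e\<close> is an orthonormal basis
  (for the rotation) and \<open>u\<close> is a unit vector; see \<open>ex1_axis_rotation\<close> and
  \<open>ex1_plane_symmetry\<close> below.\<close>

definition axis_rotation :: "(3 \<Rightarrow> 'a::real_inner) \<Rightarrow> 'a \<Rightarrow> real \<Rightarrow> 'a \<Rightarrow> 'a"
  where "axis_rotation e u \<alpha> = (THE r. linear r \<and> r u = u \<and>
    (\<forall>v. norm v = 1 \<and> orthogonal u v \<longrightarrow>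
       r v = cos \<alpha> *\<^sub>R v + sin \<alpha> *\<^sub>R vector_prod e u v \<and>
       r (vector_prod e u v) = - sin \<alpha> *\<^sub>R v + cos \<alpha> *\<^sub>R vector_prod e u v))"

definition plane_symmetry :: "'a::real_inner \<Rightarrow> 'a \<Rightarrow> 'a"
  where "plane_symmetry u = (THE s. linear s \<and> s u = - u \<and>
    (\<forall>v \<in> orthogonal_comp (span {u}). s v = v))"

definition real_subfield_generated :: "real set \<Rightarrow> real set"
  where "real_subfield_generated H = generate_field ring_of_type_algebra H"

lemma coords_nth:
  assumes "orthonormal_basis e"
  shows "coords e v $ i = v \<bullet> e i"
proof -
  have on: "\<And>i j. e i \<bullet> e j = (if i = j then 1 else 0)" and sp: "span (range e) = UNIV"
    using assms by (auto simp: orthonormal_basis_def)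
  have inj: "inj e"
    using on by (metis injI zero_neq_one)
  have po: "pairwise orthogonal (range e)"
    using on by (auto simp: pairwise_def orthogonal_def)
  have nz: "0 \<notin> range e"
    using on by (metis imageE inner_zero_left zero_neq_one)
  have ind: "independent (range e)"
    using pairwise_orthogonal_independent[OF po nz] .
  have "v = (\<Sum>b\<in>range e. representation (range e) v b *\<^sub>R b)"
    using real_vector.sum_representation_eq[OF ind, of v "range e"] sp by simp
  also have "\<dots> = (\<Sum>j\<in>UNIV. representation (range e) v (e j) *\<^sub>R e j)"
    by (simp add: sum.reindex[OF inj])
  finally have "v \<bullet> e i = (\<Sum>j\<in>UNIV. representation (range e) v (e j) *\<^sub>R e j) \<bullet> e i"
    by simp
  also have "\<dots> = representation (range e) v (e i)"
    by (simp add: inner_sum_left on if_distrib cong: if_cong)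
  finally show ?thesis by (simp add: coords_def)
qed

lemma coords_inject:
  assumes "orthonormal_basis e" "coords e v = coords e w"
  shows "v = w"
proof -
  have "(v - w) \<bullet> e i = 0" for i
    using assms by (metis coords_nth inner_diff_left right_minus_eq)
  then have "\<forall>x \<in> span (range e). orthogonal (v - w) x"
    by (auto simp: orthogonal_def intro: orthogonal_to_span[unfolded orthogonal_def])
  then have "orthogonal (v - w) (v - w)"
    using assms(1) by (simp add: orthonormal_basis_def)
  then show ?thesis by (simp add: orthogonal_def)
qed

lemma coords_linear:
  assumes "orthonormal_basis e"
  shows "coords e (v + w) = coords e v + coords e w" "coords e (k *\<^sub>R v) = k *\<^sub>R coords e v"
  by (simp_all add: vec_eq_iff coords_nth[OF assms] inner_add_left)

lemma coords_vector_prod: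
  assumes "orthonormal_basis e"
  shows "coords e (vector_prod e v w) = cross3 (coords e v) (coords e w)"
proof -
  have on: "\<And>i j. e i \<bullet> e j = (if i = j then 1 else 0)"
    using assms by (auto simp: orthonormal_basis_def)
  show ?thesis
    by (simp add: vec_eq_iff coords_nth[OF assms] vector_prod_def inner_sum_left on
        if_distrib cong: if_cong)
qed

lemma coords_inner:
  assumes "orthonormal_basis e"
  shows "coords e v \<bullet> coords e w = v \<bullet> w"
proof -
  have on: "\<And>i j. e i \<bullet> e j = (if i = j then 1 else 0)"
    using assms by (auto simp: orthonormal_basis_def)
  have "v = (\<Sum>i\<in>UNIV. (v \<bullet> e i) *\<^sub>R e i)"
    by (rule coords_inject[OF assms])
      (simp add: vec_eq_iff coords_nth[OF assms] inner_sum_left on if_distrib cong: if_cong)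
  then have "v \<bullet> w = (\<Sum>i\<in>UNIV. (v \<bullet> e i) *\<^sub>R e i) \<bullet> w" by simp
  also have "\<dots> = (\<Sum>i\<in>UNIV. (v \<bullet> e i) * (w \<bullet> e i))"
    by (simp add: inner_sum_left inner_commute[of w])
  finally show ?thesis
    by (simp add: inner_vec_def coords_nth[OF assms])
qed

lemma orthogonal_comp_span_singleton:
  "v \<in> orthogonal_comp (span {u}) \<longleftrightarrow> orthogonal u v"
  by (auto simp: orthogonal_comp_def span_singleton orthogonal_def)

lemma ex1_plane_symmetry:
  fixes u :: "'a::real_inner"
  assumes "norm u = 1"
  shows "\<exists>!s. linear s \<and> s u = - u \<and> (\<forall>v \<in> orthogonal_comp (span {u}). s v = v)"
proof (rule ex_ex1I)
  have uu: "u \<bullet> u = 1" using assms by (simp add: norm_eq_1)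
  show "\<exists>s. linear s \<and> s u = - u \<and> (\<forall>v \<in> orthogonal_comp (span {u}). s v = v)"
    using uu
    by (intro exI[of _ "\<lambda>v. v - (2 * (u \<bullet> v)) *\<^sub>R u"])
      (auto simp: orthogonal_comp_span_singleton orthogonal_def inner_add_right
        algebra_simps scaleR_2 intro!: linearI)
next
  have uu: "u \<bullet> u = 1" using assms by (simp add: norm_eq_1)
  fix s t :: "'a \<Rightarrow> 'a"
  assume s: "linear s \<and> s u = - u \<and> (\<forall>v \<in> orthogonal_comp (span {u}). s v = v)"
    and t: "linear t \<and> t u = - u \<and> (\<forall>v \<in> orthogonal_comp (span {u}). t v = v)"
  show "s = t"
  proof
    fix v
    define p where "p = v - (u \<bullet> v) *\<^sub>R u"
    have v: "v = (u \<bullet> v) *\<^sub>R u + p" by (simp add: p_def)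
    have p: "p \<in> orthogonal_comp (span {u})"
      unfolding orthogonal_comp_span_singleton by (simp add: p_def orthogonal_def inner_diff_right uu)
    have "f v = (u \<bullet> v) *\<^sub>R (- u) + p"
      if "linear f \<and> f u = - u \<and> (\<forall>v \<in> orthogonal_comp (span {u}). f v = v)" for f :: "'a \<Rightarrow> 'a"
      using that p by (subst v) (simp add: linear_add linear_scale)
    then show "s v = t v" using s t by metis
  qed
qed

lemma ex1_axis_rotation:
  fixes u :: "'a::real_inner"
  assumes e: "orthonormal_basis e" and "norm u = 1"
  shows "\<exists>!r. linear r \<and> r u = u \<and>
    (\<forall>v. norm v = 1 \<and> orthogonal u v \<longrightarrow>
       r v = cos \<alpha> *\<^sub>R v + sin \<alpha> *\<^sub>R vector_prod e u v \<and>
       r (vector_prod e u v) = - sin \<alpha> *\<^sub>R v + cos \<alpha> *\<^sub>R vector_prod e u v)"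
    (is "\<exists>!r. ?P r")
proof (rule ex_ex1I)
  have uu: "u \<bullet> u = 1" using assms by (simp add: norm_eq_1)
  note inj = coords_inject[OF e]
  note cs = coords_linear[OF e] coords_vector_prod[OF e]
  have add: "vector_prod e u (v + w) = vector_prod e u v + vector_prod e u w" for v w
    by (rule inj) (simp add: cs cross_add_right)
  have scale: "vector_prod e u (k *\<^sub>R w) = k *\<^sub>R vector_prod e u w" for k w
    by (rule inj) (simp add: cs cross_mult_right)
  have self: "vector_prod e u u = 0"
    by (rule inj) (simp add: cs, simp add: vec_eq_iff coords_nth[OF e])
  have perp: "u \<bullet> vector_prod e u v = 0" for v
    using dot_cross_self(1)[of "coords e u" "coords e v"]
    unfolding coords_vector_prod[OF e, symmetric] coords_inner[OF e] .
  have twice: "vector_prod e u (vector_prod e u v) = - v" if "u \<bullet> v = 0" for v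
  proof (rule inj)
    have m: "coords e (- v) = - coords e v" using cs(2)[of "-1" v] by simp
    have "cross3 (coords e u) (cross3 (coords e u) (coords e v))
        = (coords e u \<bullet> coords e v) *\<^sub>R coords e u - (coords e u \<bullet> coords e u) *\<^sub>R coords e v"
      by (simp add: cross3_simps) (simp add: forall_3 algebra_simps)
    then show "coords e (vector_prod e u (vector_prod e u v)) = coords e (- v)"
      by (simp add: cs m coords_inner[OF e] that uu)
  qed
  let ?r = "\<lambda>v. (u \<bullet> v) *\<^sub>R u + cos \<alpha> *\<^sub>R (v - (u \<bullet> v) *\<^sub>R u) + sin \<alpha> *\<^sub>R vector_prod e u v"
  have "linear ?r"
    by (rule linearI) (simp_all add: add scale inner_add_right algebra_simps)
  then have "?P ?r"
    by (auto simp: uu self perp orthogonal_def twice)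
  then show "\<exists>r. ?P r"
    by (rule exI[where P = ?P and x = ?r])
next
  have uu: "u \<bullet> u = 1" using assms by (simp add: norm_eq_1)
  fix r t :: "'a \<Rightarrow> 'a"
  assume r: "?P r" and t: "?P t"
  show "r = t"
  proof
    fix v
    define p where "p = v - (u \<bullet> v) *\<^sub>R u"
    have v: "v = (u \<bullet> v) *\<^sub>R u + p" by (simp add: p_def)
    have up: "u \<bullet> p = 0"
      by (simp add: p_def inner_diff_right uu)
    have "r (sgn p) = t (sgn p)"
    proof (cases "p = 0")
      case True
      then show ?thesis using r t by (simp add: linear_0)
    next
      case False
      then have "norm (sgn p) = 1 \<and> orthogonal u (sgn p)"
        using up by (simp add: norm_sgn orthogonal_def sgn_div_norm)
      then show ?thesis using r t by simp
    qed
    moreover have "p = norm p *\<^sub>R sgn p" by (cases "p = 0") (simp_all add: sgn_div_norm)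
    ultimately have "r p = t p" using r t by (metis linear_scale)
    then have "r ((u \<bullet> v) *\<^sub>R u + p) = t ((u \<bullet> v) *\<^sub>R u + p)"
      using r t by (simp add: linear_add linear_scale)
    then show "r v = t v" by (simp flip: v)
  qed
qed

end

theory Submission
  imports Defs
begin

text \<open>
  Both maps have closed formulas in \<open>V\<close>: the symmetry is \<open>v - 2\<langle>u,v\<rangle>u\<close>, and the rotation is given
  by Rodrigues' formula, since the component \<open>v - \<langle>u,v\<rangle>u\<close> of \<open>v\<close> perpendicular to \<open>u\<close> is a multiple
  of a unit vector to which the defining condition applies (lemmas \<open>plane_symmetry_eq\<close> and
  \<open>axis_rotation_eq\<close>). The rotation fixes \<open>u\<close> and preserves \<open>\<langle>u,v\<rangle>\<close>, so both compositions send
  \<open>v\<close> to \<open>r v - 2\<langle>u,v\<rangle>u\<close>, whence they agree.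

  In coordinates the projection \<open>v \<mapsto> \<langle>u,v\<rangle>u\<close> has matrix \<open>A\<close> and the map \<open>v \<mapsto> u \<and> v\<close> has matrix \<open>B\<close>.
  Hence \<open>S = I - 2A\<close> and \<open>R = A + (cos \<alpha>)(I - A) + (sin \<alpha>)B\<close>, and the composition has matrix
  \<open>R - 2A = S + (sin \<alpha>)B + (cos \<alpha> - 1)(I - A)\<close>. It is also \<open>SR\<close> and \<open>RS\<close>, because matrices of linear
  maps multiply under composition. Its entries are polynomials with integer coefficients in
  \<open>a, b, c, cos \<alpha>, sin \<alpha>\<close>, so they lie in any field that contains these numbers.
\<close>

section \<open>Closed formulas for the symmetry and the rotation\<close>

lemma plane_symmetry_eq:
  fixes u :: "'a::real_inner"
  assumes "norm u = 1"
  shows "plane_symmetry u v = v - (2 * (u \<bullet> v)) *\<^sub>R u"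
proof -
  let ?s = "plane_symmetry u" and ?p = "v - (u \<bullet> v) *\<^sub>R u"
  have s: "linear ?s \<and> ?s u = - u \<and> (\<forall>v \<in> orthogonal_comp (span {u}). ?s v = v)"
    unfolding plane_symmetry_def by (rule theI'[OF ex1_plane_symmetry[OF assms]])
  have "u \<bullet> ?p = 0"
    using assms by (simp add: inner_diff_right norm_eq_1)
  then have "?s ?p = ?p"
    using s by (simp add: orthogonal_comp_span_singleton orthogonal_def)
  then have "?s v - (u \<bullet> v) *\<^sub>R (- u) = ?p"
    using s by (simp add: linear_diff linear_scale)
  then show ?thesis
    by (simp add: algebra_simps eq_diff_eq flip: scaleR_2)
qed

lemma vector_prod_linear:
  assumes "orthonormal_basis e"
  shows "linear (vector_prod e u)"
  by (rule linearI; rule coords_inject[OF assms])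
    (simp_all add: coords_linear[OF assms] coords_vector_prod[OF assms]
      cross_add_right cross_mult_right)

lemma vector_prod_self: "vector_prod e u u = 0"
  unfolding vector_prod_def by simp

lemma inner_vector_prod_self:
  assumes "orthonormal_basis e"
  shows "u \<bullet> vector_prod e u v = 0"
  using dot_cross_self(1)[of "coords e u" "coords e v"]
  unfolding coords_vector_prod[OF assms, symmetric] coords_inner[OF assms] .

lemma axis_rotation_linear:
  assumes "orthonormal_basis e" "norm u = 1"
  shows "linear (axis_rotation e u \<alpha>)"
  using theI'[OF ex1_axis_rotation[OF assms, of \<alpha>]] unfolding axis_rotation_def by blast

text \<open>Rodrigues' formula. The perpendicular component of \<open>v\<close> is rescaled to a unit vector, on which
  the rotation is prescribed, and \<open>u \<and> v\<close> does not see the component along \<open>u\<close>.\<close>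

lemma axis_rotation_eq:
  fixes u :: "'a::real_inner"
  assumes e: "orthonormal_basis e" and u: "norm u = 1"
  shows "axis_rotation e u \<alpha> v
    = (u \<bullet> v) *\<^sub>R u + cos \<alpha> *\<^sub>R (v - (u \<bullet> v) *\<^sub>R u) + sin \<alpha> *\<^sub>R vector_prod e u v"
proof -
  let ?r = "axis_rotation e u \<alpha>"
  define p where "p = v - (u \<bullet> v) *\<^sub>R u"
  have r: "linear ?r \<and> ?r u = u \<and>
    (\<forall>v. norm v = 1 \<and> orthogonal u v \<longrightarrow>
       ?r v = cos \<alpha> *\<^sub>R v + sin \<alpha> *\<^sub>R vector_prod e u v \<and>
       ?r (vector_prod e u v) = - sin \<alpha> *\<^sub>R v + cos \<alpha> *\<^sub>R vector_prod e u v)"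
    unfolding axis_rotation_def by (rule theI'[OF ex1_axis_rotation[OF e u]])
  note lin = vector_prod_linear[OF e, of u]
  have up: "u \<bullet> p = 0"
    using u by (simp add: p_def inner_diff_right norm_eq_1)
  have "?r p = cos \<alpha> *\<^sub>R p + sin \<alpha> *\<^sub>R vector_prod e u p"
  proof (cases "p = 0")
    case True
    then show ?thesis using r lin by (simp add: linear_0)
  next
    case False
    have p: "p = norm p *\<^sub>R sgn p"
      by (simp add: False sgn_div_norm)
    have "norm (sgn p) = 1 \<and> orthogonal u (sgn p)"
      using up False by (simp add: norm_sgn orthogonal_def sgn_div_norm)
    then have "?r (sgn p) = cos \<alpha> *\<^sub>R sgn p + sin \<alpha> *\<^sub>R vector_prod e u (sgn p)"
      using r by blast
    then have "?r (norm p *\<^sub>R sgn p) = cos \<alpha> *\<^sub>R (norm p *\<^sub>R sgn p)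
        + sin \<alpha> *\<^sub>R vector_prod e u (norm p *\<^sub>R sgn p)"
      using r lin by (simp add: linear_scale scaleR_right_distrib mult.commute)
    then show ?thesis by (simp flip: p)
  qed
  moreover have "vector_prod e u p = vector_prod e u v"
    using lin by (simp add: p_def linear_diff linear_scale vector_prod_self)
  moreover have "?r v = (u \<bullet> v) *\<^sub>R u + ?r p"
    using r by (simp add: p_def linear_diff linear_scale)
  ultimately show ?thesis by (simp add: p_def)
qed

section \<open>Matrices of linear maps\<close>

lemma coords_expansion:
  assumes "orthonormal_basis e"
  shows "v = (\<Sum>i\<in>UNIV. (coords e v $ i) *\<^sub>R e i)"
proof (rule coords_inject[OF assms])
  have on: "e i \<bullet> e j = (if i = j then 1 else 0)" for i j
    using assms by (auto simp: orthonormal_basis_def)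
  show "coords e v = coords e (\<Sum>i\<in>UNIV. (coords e v $ i) *\<^sub>R e i)"
    by (simp add: vec_eq_iff coords_nth[OF assms] inner_sum_left on if_distrib cong: if_cong)
qed

lemma matrix_wrt_comp:
  assumes e: "orthonormal_basis e" and f: "linear f"
  shows "matrix_wrt e (f \<circ> g) = matrix_wrt e f ** matrix_wrt e g"
proof -
  have "f (g (e j)) = (\<Sum>k\<in>UNIV. (coords e (g (e j)) $ k) *\<^sub>R f (e k))" for j
    by (subst coords_expansion[OF e, of "g (e j)"]) (simp add: linear_sum[OF f] linear_scale[OF f])
  then show ?thesis
    by (simp add: vec_eq_iff matrix_wrt_def matrix_matrix_mult_def coords_nth[OF e]
        inner_sum_left mult.commute)
qed

section \<open>The generated subfield\<close>

lemma
  shows one_in_real_subfield_generated: "1 \<in> real_subfield_generated H"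
    and incl_in_real_subfield_generated: "x \<in> H \<Longrightarrow> x \<in> real_subfield_generated H"
    and add_in_real_subfield_generated: "x \<in> real_subfield_generated H
      \<Longrightarrow> y \<in> real_subfield_generated H \<Longrightarrow> x + y \<in> real_subfield_generated H"
    and mult_in_real_subfield_generated: "x \<in> real_subfield_generated H
      \<Longrightarrow> y \<in> real_subfield_generated H \<Longrightarrow> x * y \<in> real_subfield_generated H"
  using generate_field.one[of "ring_of_type_algebra :: real ring" H]
    generate_field.incl[of x H "ring_of_type_algebra :: real ring"]
    generate_field.eng_add[of x "ring_of_type_algebra :: real ring" H y]
    generate_field.eng_mult[of x "ring_of_type_algebra :: real ring" H y]
  by (simp_all add: real_subfield_generated_def ring_of_type_algebra_def)

lemma uminus_in_real_subfield_generated: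
  assumes "x \<in> real_subfield_generated H"
  shows "- x \<in> real_subfield_generated H"
proof -
  interpret ring "ring_of_type_algebra :: real ring"
    using ring_from_type_algebra by blast
  have "x \<oplus>\<^bsub>ring_of_type_algebra\<^esub> (- x) = \<zero>\<^bsub>ring_of_type_algebra\<^esub>"
    by (simp add: ring_of_type_algebra_def)
  then have "\<ominus>\<^bsub>ring_of_type_algebra\<^esub> x = - x"
    by (intro minus_equality) (simp_all add: ring_of_type_algebra_def)
  then show ?thesis
    using generate_field.a_inv[of x "ring_of_type_algebra :: real ring" H] assms
    by (simp add: real_subfield_generated_def)
qed

lemma diff_in_real_subfield_generated:
  assumes "x \<in> real_subfield_generated H" "y \<in> real_subfield_generated H"
  shows "x - y \<in> real_subfield_generated H"
  using add_in_real_subfield_generated[OF assms(1) uminus_in_real_subfield_generated[OF assms(2)]]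
  by simp

section \<open>The roto-symmetry\<close>

theorem mainTheorem2:
  fixes e :: "3 \<Rightarrow> 'a::real_inner" and u :: 'a
    and a b c \<alpha> :: real and R S A B :: "real^3^3"
  assumes "dim (UNIV :: 'a set) = 3"
    and "orthonormal_basis e"
    and "norm u = 1"
    and "coords e u = vector [a, b, c]"
    and "0 \<le> \<alpha>" and "\<alpha> < 2 * pi"
    and "R = matrix_wrt e (axis_rotation e u \<alpha>)"
    and "S = matrix_wrt e (plane_symmetry u)"
    and "A = vector [vector [a\<^sup>2, a * b, a * c],
                     vector [a * b, b\<^sup>2, b * c],
                     vector [a * c, b * c, c\<^sup>2]]"
    and "B = vector [vector [0, - c, b],
                     vector [c, 0, - a],
                     vector [- b, a, 0]]"
  shows "plane_symmetry u \<circ> axis_rotation e u \<alpha> = axis_rotation e u \<alpha> \<circ> plane_symmetry u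
    \<and> matrix_wrt e (plane_symmetry u \<circ> axis_rotation e u \<alpha>) = S ** R
    \<and> S ** R = R ** S
    \<and> R ** S = S + sin \<alpha> *\<^sub>R B + (cos \<alpha> - 1) *\<^sub>R (mat 1 - A)
    \<and> (\<forall>i j. (S + sin \<alpha> *\<^sub>R B + (cos \<alpha> - 1) *\<^sub>R (mat 1 - A)) $ i $ j
          \<in> real_subfield_generated {a, b, c, cos \<alpha>, sin \<alpha>})"
proof -
  note e = assms(2) and u = assms(3) and coords_u = assms(4)
  let ?r = "axis_rotation e u \<alpha>" and ?s = "plane_symmetry u"
  have on: "e i \<bullet> e j = (if i = j then 1 else 0)" for i j
    using e by (auto simp: orthonormal_basis_def)
  have ue: "u \<bullet> e 1 = a" "u \<bullet> e 2 = b" "u \<bullet> e 3 = c"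
    using coords_nth[OF e, of u 1] coords_nth[OF e, of u 2] coords_nth[OF e, of u 3]
    by (simp_all add: coords_u)
  have A: "A $ i $ j = (u \<bullet> e i) * (u \<bullet> e j)" for i j
    using exhaust_3[of i] exhaust_3[of j]
    by (auto simp: assms(9) ue power2_eq_square)
  have B: "B $ i $ j = vector_prod e u (e j) \<bullet> e i" for i j
  proof -
    have "B $ i $ j = cross3 (coords e u) (coords e (e j)) $ i"
      using exhaust_3[of i] exhaust_3[of j]
      by (auto simp: assms(10) coords_u cross3_def coords_nth[OF e] on)
    then show ?thesis
      by (simp add: coords_nth[OF e] flip: coords_vector_prod[OF e])
  qed
  have lin_r: "linear ?r"
    by (rule axis_rotation_linear[OF e u])
  have lin_s: "linear ?s"
    by (rule linearI) (simp_all add: plane_symmetry_eq[OF u] inner_add_right algebra_simps)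
  have uu: "u \<bullet> u = 1"
    using u by (simp add: norm_eq_1)
  have ru: "?r u = u"
    by (simp add: axis_rotation_eq[OF e u] uu vector_prod_self)
  have ur: "u \<bullet> ?r v = u \<bullet> v" for v
    by (simp add: axis_rotation_eq[OF e u] inner_add_right inner_diff_right uu
        inner_vector_prod_self[OF e])
  have sr: "?s (?r v) = ?r v - (2 * (u \<bullet> v)) *\<^sub>R u" for v
    by (simp add: plane_symmetry_eq[OF u] ur)
  have comm: "?s \<circ> ?r = ?r \<circ> ?s"
    using lin_r
    by (simp add: fun_eq_iff sr) (simp add: plane_symmetry_eq[OF u] linear_diff linear_scale ru)
  have SR: "matrix_wrt e (?s \<circ> ?r) = S ** R" and RS: "matrix_wrt e (?r \<circ> ?s) = R ** S"
    using assms(7,8) matrix_wrt_comp[OF e] lin_r lin_s by simp_all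
  have S: "S $ i $ j = (mat 1 :: real^3^3) $ i $ j - 2 * A $ i $ j" for i j
    by (simp add: assms(8) matrix_wrt_def coords_nth[OF e] plane_symmetry_eq[OF u]
        inner_diff_left on A mat_def)
  have "matrix_wrt e (?s \<circ> ?r) $ i $ j = ?r (e j) \<bullet> e i - 2 * A $ i $ j" for i j
    by (simp add: matrix_wrt_def coords_nth[OF e] sr A inner_diff_left mult.commute)
  then have R: "matrix_wrt e (?s \<circ> ?r) = S + sin \<alpha> *\<^sub>R B + (cos \<alpha> - 1) *\<^sub>R (mat 1 - A)"
    by (simp add: vec_eq_iff S axis_rotation_eq[OF e u] inner_diff_left inner_add_left on A B
        mat_def algebra_simps)
  let ?K = "real_subfield_generated {a, b, c, cos \<alpha>, sin \<alpha>}"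
  note K = one_in_real_subfield_generated add_in_real_subfield_generated
    mult_in_real_subfield_generated diff_in_real_subfield_generated
    uminus_in_real_subfield_generated
  have gens: "a \<in> ?K" "b \<in> ?K" "c \<in> ?K" "cos \<alpha> \<in> ?K" "sin \<alpha> \<in> ?K"
    by (simp_all add: incl_in_real_subfield_generated)
  have zero: "0 \<in> ?K" and two: "2 \<in> ?K"
    using diff_in_real_subfield_generated[of 1 _ 1] add_in_real_subfield_generated[of 1 _ 1]
    by (simp_all add: one_in_real_subfield_generated)
  have "A $ i $ j \<in> ?K" and "B $ i $ j \<in> ?K" and "(mat 1 :: real^3^3) $ i $ j \<in> ?K" for i j
    using exhaust_3[of i] exhaust_3[of j]
    by (auto simp: assms(9,10) mat_def power2_eq_square intro!: K gens zero)
  then have "(S + sin \<alpha> *\<^sub>R B + (cos \<alpha> - 1) *\<^sub>R (mat 1 - A)) $ i $ j \<in> ?K" for i j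
    by (simp add: S) (intro K gens two; assumption?)
  then show ?thesis
    using comm SR RS R by metis
qed

end
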